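(* Let $R$ be a separative exchange ring in which $2$ is invertible, and let $a\in R$ be such that $a-a^3$ is regular. Suppose (1) the right $R$-modules $aR/ar(a^2)$ and $R/\big(aR+r(a)\big)$ are projective, and (2) $Rar(a^2)=\ell(a^2)aR=R(1-a^2)R$. Then $a$ is special clean, i.e., there exists an idempotent $e\in R$ such that $a-e$ is a unit of $R$ and $aR\cap eR=0$.
   Context: All rings are associative with identity; modules are right modules. An element $x\in R$ is regular if $x=xyx$ for some $y\in R$. $R$ is an exchange ring if for every $x\in R$ there is an idempotent $e\in xR$ with $1-e\in(1-x)R$. $R$ is separative if for all finitely generated projective right $R$-modules $A,B$: $A\oplus A\cong A\oplus B\cong B\oplus B$ implies $A\cong B$. For $x\in R$, $r(x)=\{y\in R: xy=0\}$ and $\ell(x)=\{y\in R: yx=0\}$. $ar(a^2)=\{ay: y\in r(a^2)\}$; $Rar(a^2)$ and $\ell(a^2)aR$ denote the two-sided ideals generated by $ar(a^2)$ and $\ell(a^2)a$ respectively, and $R(1-a^2)R$ the two-sided ideal generated by $1-a^2$. *)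

theory Defs
  imports Main
begin

record ('m, 'r) rmod =
  mcarr :: "'m set"
  mzero :: 'm
  madd  :: "'m \<Rightarrow> 'm \<Rightarrow> 'm"
  msmul :: "'m \<Rightarrow> 'r \<Rightarrow> 'm"

definition is_rmod :: "('m, 'r::ring_1) rmod \<Rightarrow> bool" where
  "is_rmod M \<longleftrightarrow>
     mzero M \<in> mcarr M \<and>
     (\<forall>x\<in>mcarr M. \<forall>y\<in>mcarr M. madd M x y \<in> mcarr M) \<and>
     (\<forall>x\<in>mcarr M. \<forall>r. msmul M x r \<in> mcarr M) \<and>
     (\<forall>x\<in>mcarr M. \<forall>y\<in>mcarr M. \<forall>z\<in>mcarr M. madd M (madd M x y) z = madd M x (madd M y z)) \<and>
     (\<forall>x\<in>mcarr M. \<forall>y\<in>mcarr M. madd M x y = madd M y x) \<and>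
     (\<forall>x\<in>mcarr M. madd M (mzero M) x = x) \<and>
     (\<forall>x\<in>mcarr M. \<exists>y\<in>mcarr M. madd M x y = mzero M) \<and>
     (\<forall>x\<in>mcarr M. \<forall>y\<in>mcarr M. \<forall>r. msmul M (madd M x y) r = madd M (msmul M x r) (msmul M y r)) \<and>
     (\<forall>x\<in>mcarr M. \<forall>r s. msmul M x (r + s) = madd M (msmul M x r) (msmul M x s)) \<and>
     (\<forall>x\<in>mcarr M. \<forall>r s. msmul M x (r * s) = msmul M (msmul M x r) s) \<and>
     (\<forall>x\<in>mcarr M. msmul M x 1 = x)"

definition rlinear :: "('m, 'r) rmod \<Rightarrow> ('n, 'r) rmod \<Rightarrow> ('m \<Rightarrow> 'n) \<Rightarrow> bool" where
  "rlinear M N f \<longleftrightarrow>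
     (\<forall>x\<in>mcarr M. f x \<in> mcarr N) \<and>
     (\<forall>x\<in>mcarr M. \<forall>y\<in>mcarr M. f (madd M x y) = madd N (f x) (f y)) \<and>
     (\<forall>x\<in>mcarr M. \<forall>r. f (msmul M x r) = msmul N (f x) r)"

definition rmod_iso :: "('m, 'r) rmod \<Rightarrow> ('n, 'r) rmod \<Rightarrow> bool" where
  "rmod_iso M N \<longleftrightarrow> (\<exists>f. rlinear M N f \<and> bij_betw f (mcarr M) (mcarr N))"

definition dsum :: "('m, 'r) rmod \<Rightarrow> ('n, 'r) rmod \<Rightarrow> ('m \<times> 'n, 'r) rmod" where
  "dsum M N = \<lparr> mcarr = mcarr M \<times> mcarr N, mzero = (mzero M, mzero N),
     madd = (\<lambda>(x1, y1) (x2, y2). (madd M x1 x2, madd N y1 y2)),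
     msmul = (\<lambda>(x, y) r. (msmul M x r, msmul N y r)) \<rparr>"

definition free_rmod :: "'i set \<Rightarrow> ('i \<Rightarrow> 'r::ring_1, 'r) rmod" where
  "free_rmod I = \<lparr> mcarr = {f. finite {i. f i \<noteq> 0} \<and> (\<forall>i. i \<notin> I \<longrightarrow> f i = 0)},
     mzero = (\<lambda>i. 0), madd = (\<lambda>f g i. f i + g i), msmul = (\<lambda>f r i. f i * r) \<rparr>"

definition projective :: "('m, 'r::ring_1) rmod \<Rightarrow> bool" where
  "projective M \<longleftrightarrow> (\<exists>s p. rlinear M (free_rmod (mcarr M)) s \<and>
       rlinear (free_rmod (mcarr M)) M p \<and> (\<forall>x\<in>mcarr M. p (s x) = x))"

fun lincomb :: "('m, 'r) rmod \<Rightarrow> 'm list \<Rightarrow> 'r list \<Rightarrow> 'm" where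
  "lincomb M (x # xs) (r # rs) = madd M (msmul M x r) (lincomb M xs rs)"
| "lincomb M _ _ = mzero M"

definition fin_gen :: "('m, 'r) rmod \<Rightarrow> bool" where
  "fin_gen M \<longleftrightarrow> (\<exists>xs. set xs \<subseteq> mcarr M \<and>
     (\<forall>m\<in>mcarr M. \<exists>rs. length rs = length xs \<and> m = lincomb M xs rs))"

text \<open>Separative ring. Every finitely generated module over R has an isomorphic
  copy whose carrier lies in the type nat => R, so quantifying over modules on
  that type covers all finitely generated projective modules up to isomorphism.\<close>
definition separative :: "'r::ring_1 itself \<Rightarrow> bool" where
  "separative (T::'r itself) \<longleftrightarrow>
     (\<forall>(A :: (nat \<Rightarrow> 'r, 'r) rmod) (B :: (nat \<Rightarrow> 'r, 'r) rmod).
        is_rmod A \<and> is_rmod B \<and> fin_gen A \<and> fin_gen B \<and> projective A \<and> projective B \<and>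
        rmod_iso (dsum A A) (dsum A B) \<and> rmod_iso (dsum A B) (dsum B B) \<longrightarrow> rmod_iso A B)"

definition exchange_ring :: "'r::ring_1 itself \<Rightarrow> bool" where
  "exchange_ring (T::'r itself) \<longleftrightarrow>
     (\<forall>x::'r. \<exists>e. e * e = e \<and> (\<exists>s. e = x * s) \<and> (\<exists>t. 1 - e = (1 - x) * t))"

definition regular :: "'r::ring_1 \<Rightarrow> bool" where
  "regular x \<longleftrightarrow> (\<exists>y. x = x * y * x)"

definition is_unit :: "'r::ring_1 \<Rightarrow> bool" where
  "is_unit x \<longleftrightarrow> (\<exists>y. x * y = 1 \<and> y * x = 1)"

definition rann :: "'r::ring_1 \<Rightarrow> 'r set" where
  "rann x = {y. x * y = 0}"

definition lann :: "'r::ring_1 \<Rightarrow> 'r set" where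
  "lann x = {y. y * x = 0}"

definition two_sided_ideal :: "'r::ring_1 set \<Rightarrow> bool" where
  "two_sided_ideal I \<longleftrightarrow> 0 \<in> I \<and> (\<forall>x\<in>I. \<forall>y\<in>I. x + y \<in> I) \<and> (\<forall>x\<in>I. - x \<in> I) \<and>
     (\<forall>x\<in>I. \<forall>r. r * x \<in> I \<and> x * r \<in> I)"

definition gen_ideal :: "'r::ring_1 set \<Rightarrow> 'r set" where
  "gen_ideal S = \<Inter>{I. two_sided_ideal I \<and> S \<subseteq> I}"

definition quot_rmod :: "'r::ring_1 set \<Rightarrow> 'r set \<Rightarrow> ('r set, 'r) rmod" where
  "quot_rmod N K = \<lparr> mcarr = {(\<lambda>k. x + k) ` K | x. x \<in> N}, mzero = K,
     madd = (\<lambda>C D. {c + d | c d. c \<in> C \<and> d \<in> D}),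
     msmul = (\<lambda>C r. {c * r + k | c k. c \<in> C \<and> k \<in> K}) \<rparr>"

end

theory Submission
  imports Defs
begin

text \<open>Regularity of \<open>a\<close> (inherited from \<open>a - a^3\<close>) and the two projectivity hypotheses give
  \<open>R = X \<oplus> Y \<oplus> Z \<oplus> W\<close> with \<open>aR = X \<oplus> Y\<close> and \<open>r(a) = X \<oplus> Z\<close>. If \<open>X \<cong> W\<close> via \<open>\<alpha>\<close>, then \<open>Z \<oplus> W\<close>,
  a complement of \<open>aR\<close>, and \<open>r(a)\<close> share the complement \<open>Y \<oplus> {x + \<alpha> x | x \<in> X}\<close>, and the projection
  onto \<open>Z \<oplus> W\<close> along it is the idempotent sought. With \<open>U = (a - a^3)R\<close>, both \<open>U \<oplus> r(a)\<close> and
  \<open>U \<oplus> Z \<oplus> W\<close> are isomorphic to \<open>(1 - a^2)R\<close>, so \<open>X \<oplus> (U \<oplus> Z) \<cong> W \<oplus> (U \<oplus> Z)\<close>.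
  The ideal hypotheses say that \<open>U\<close> and \<open>Z\<close>, which lie in \<open>R(1 - a^2)R\<close>, are summands of finite
  direct sums of copies of \<open>X\<close> and of copies of \<open>W\<close>; separativity then cancels \<open>U \<oplus> Z\<close>.\<close>

section \<open>Isomorphisms of modules\<close>

text \<open>The part of the module structure that makes the inverse of a linear bijection linear;
  the chains of isomorphisms below track only this.\<close>

definition op_closed :: "('m, 'r) rmod \<Rightarrow> bool" where
  "op_closed M \<longleftrightarrow> (\<forall>x\<in>mcarr M. \<forall>y\<in>mcarr M. madd M x y \<in> mcarr M) \<and>
     (\<forall>x\<in>mcarr M. \<forall>r. msmul M x r \<in> mcarr M)"

lemma op_closed_dsum: "op_closed M \<Longrightarrow> op_closed N \<Longrightarrow> op_closed (dsum M N)"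
  by (auto simp: op_closed_def dsum_def)

lemma rmod_isoI:
  assumes "rlinear M N f"
    and "\<And>x. x \<in> mcarr M \<Longrightarrow> g (f x) = x"
    and "\<And>y. y \<in> mcarr N \<Longrightarrow> g y \<in> mcarr M"
    and "\<And>y. y \<in> mcarr N \<Longrightarrow> f (g y) = y"
  shows "rmod_iso M N"
  unfolding rmod_iso_def
proof (intro exI conjI)
  show "bij_betw f (mcarr M) (mcarr N)"
    by (rule bij_betw_byWitness[where f' = g]) (use assms in \<open>auto simp: rlinear_def\<close>)
qed fact

lemma rmod_isoE:
  assumes "rmod_iso M N" and "op_closed M"
  obtains f g where "rlinear M N f" "rlinear N M g"
    "\<And>x. x \<in> mcarr M \<Longrightarrow> g (f x) = x" "\<And>y. y \<in> mcarr N \<Longrightarrow> f (g y) = y"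
proof -
  obtain f where f: "rlinear M N f" "bij_betw f (mcarr M) (mcarr N)"
    using assms by (auto simp: rmod_iso_def)
  define g where "g = inv_into (mcarr M) f"
  have gf: "g (f x) = x" if "x \<in> mcarr M" for x
    using f that unfolding g_def by (simp add: bij_betw_inv_into_left)
  have fg: "f (g y) = y" if "y \<in> mcarr N" for y
    using f that unfolding g_def by (simp add: bij_betw_inv_into_right)
  have g: "g y \<in> mcarr M" if "y \<in> mcarr N" for y
    using f that unfolding g_def by (metis bij_betw_imp_surj_on inv_into_into)
  \<comment> \<open>Since \<open>M\<close> is closed, \<open>madd M (g x) (g y)\<close> lies in its
    carrier; \<open>f\<close> sends it to \<open>madd N x y\<close>, and \<open>g\<close> undoes
    \<open>f\<close>.\<close>
  have "g (madd N x y) = madd M (g x) (g y)" if "x \<in> mcarr N" "y \<in> mcarr N" for x y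
    using f(1) assms(2) g fg gf that unfolding rlinear_def op_closed_def by metis
  moreover have "g (msmul N x r) = msmul M (g x) r" if "x \<in> mcarr N" for x r
    using f(1) assms(2) g fg gf that unfolding rlinear_def op_closed_def by metis
  ultimately have "rlinear N M g"
    using g by (simp add: rlinear_def)
  with that f(1) gf fg show thesis by blast
qed

lemma rmod_iso_refl: "rmod_iso M M"
  by (rule rmod_isoI[where f = id and g = id]) (auto simp: rlinear_def)

lemma rmod_iso_sym:
  assumes "rmod_iso M N" "op_closed M"
  shows "rmod_iso N M"
proof -
  obtain f g where "rlinear M N f" "rlinear N M g"
    "\<And>x. x \<in> mcarr M \<Longrightarrow> g (f x) = x" "\<And>y. y \<in> mcarr N \<Longrightarrow> f (g y) = y"
    using rmod_isoE[OF assms] by blast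
  then show ?thesis
    by (intro rmod_isoI[where f = g and g = f]) (auto simp: rlinear_def)
qed

lemma rmod_iso_trans [trans]:
  assumes "rmod_iso M N" "rmod_iso N P"
  shows "rmod_iso M P"
proof -
  obtain f where f: "rlinear M N f" "bij_betw f (mcarr M) (mcarr N)"
    using assms by (auto simp: rmod_iso_def)
  obtain g where g: "rlinear N P g" "bij_betw g (mcarr N) (mcarr P)"
    using assms by (auto simp: rmod_iso_def)
  have "rlinear M P (g \<circ> f)"
    using f g by (simp add: rlinear_def)
  then show ?thesis
    using bij_betw_trans[OF f(2) g(2)] unfolding rmod_iso_def by blast
qed

lemma rmod_iso_dsum:
  assumes "rmod_iso M M'" "rmod_iso N N'"
  shows "rmod_iso (dsum M N) (dsum M' N')"
proof -
  obtain f where f: "rlinear M M' f" "bij_betw f (mcarr M) (mcarr M')"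
    using assms by (auto simp: rmod_iso_def)
  obtain g where g: "rlinear N N' g" "bij_betw g (mcarr N) (mcarr N')"
    using assms by (auto simp: rmod_iso_def)
  have "rlinear (dsum M N) (dsum M' N') (map_prod f g)"
    using f g by (auto simp: rlinear_def dsum_def)
  moreover have "bij_betw (map_prod f g) (mcarr (dsum M N)) (mcarr (dsum M' N'))"
    using bij_betw_map_prod[OF f(2) g(2)] by (simp add: dsum_def map_prod_def)
  ultimately show ?thesis
    by (auto simp: rmod_iso_def)
qed

lemma rmod_iso_dsum_comm: "rmod_iso (dsum M N) (dsum N M)"
  by (rule rmod_isoI[where f = prod.swap and g = prod.swap])
     (auto simp: rlinear_def dsum_def)

lemma rmod_iso_dsum_assoc: "rmod_iso (dsum (dsum M N) P) (dsum M (dsum N P))"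
  by (rule rmod_isoI[where f = "\<lambda>((x, y), z). (x, y, z)" and g = "\<lambda>(x, y, z). ((x, y), z)"])
     (auto simp: rlinear_def dsum_def)

lemma rmod_iso_dsum_assoc': "rmod_iso (dsum M (dsum N P)) (dsum (dsum M N) P)"
  by (rule rmod_isoI[where g = "\<lambda>((x, y), z). (x, y, z)" and f = "\<lambda>(x, y, z). ((x, y), z)"])
     (auto simp: rlinear_def dsum_def)

section \<open>Finitely generated projective modules from lists of idempotents\<close>

definition rsub :: "'r::ring_1 set \<Rightarrow> ('r, 'r) rmod" where
  "rsub S = \<lparr> mcarr = S, mzero = 0, madd = (+), msmul = (*) \<rparr>"

text \<open>For idempotent \<open>e\<close> the elements fixed by left multiplication by
  \<open>e\<close> form \<open>eR\<close>; membership becomes an equation fit for rewriting.\<close>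

definition prin :: "'r::ring_1 \<Rightarrow> ('r, 'r) rmod" where
  "prin e = rsub {r. e * r = r}"

text \<open>For idempotent entries, the direct sum of the modules \<open>eR\<close> along the list,
  padded by zeros so that it lives on \<open>nat \<Rightarrow> 'r\<close>, the type over which
  \<open>separative\<close> quantifies.\<close>

definition pmod :: "'r::ring_1 list \<Rightarrow> (nat \<Rightarrow> 'r, 'r) rmod" where
  "pmod es = \<lparr> mcarr = {f. (\<forall>i<length es. es ! i * f i = f i) \<and> (\<forall>i\<ge>length es. f i = 0)},
     mzero = (\<lambda>i. 0), madd = (\<lambda>f g i. f i + g i), msmul = (\<lambda>f r i. f i * r) \<rparr>"

lemma op_closed_prin: "op_closed (prin e)"
  by (auto simp: op_closed_def prin_def rsub_def algebra_simps simp flip: mult.assoc)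

lemma op_closed_pmod: "op_closed (pmod es)"
  by (auto simp: op_closed_def pmod_def algebra_simps simp flip: mult.assoc)

lemma is_rmod_pmod: "is_rmod (pmod es)"
proof -
  have "\<exists>y\<in>mcarr (pmod es). madd (pmod es) f y = mzero (pmod es)" if "f \<in> mcarr (pmod es)" for f
    using that by (intro bexI[where x = "\<lambda>i. - f i"]) (auto simp: pmod_def)
  then show ?thesis
    unfolding is_rmod_def
    by (auto simp: pmod_def algebra_simps simp flip: mult.assoc)
qed

lemma rmod_iso_pmod_append: "rmod_iso (dsum (pmod es) (pmod fs)) (pmod (es @ fs))"
proof (rule rmod_isoI)
  let ?f = "\<lambda>(f :: nat \<Rightarrow> 'a, g) i. if i < length es then f i else g (i - length es)"
  \<comment> \<open>The first component is cut off at \<open>length es\<close>; the second inherits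
    its zeros from \<open>h\<close>, which vanishes from \<open>length es + length fs\<close>
    on.\<close>
  let ?g = "\<lambda>h :: nat \<Rightarrow> 'a. (\<lambda>i. if i < length es then h i else 0, \<lambda>i. h (i + length es))"
  show "rlinear (dsum (pmod es) (pmod fs)) (pmod (es @ fs)) ?f"
    by (auto simp: rlinear_def dsum_def pmod_def nth_append fun_eq_iff)
  show "?g (?f p) = p" if "p \<in> mcarr (dsum (pmod es) (pmod fs))" for p
    using that by (auto simp: dsum_def pmod_def fun_eq_iff)
  show "?g h \<in> mcarr (dsum (pmod es) (pmod fs))" if "h \<in> mcarr (pmod (es @ fs))" for h
  proof -
    have "(es @ fs) ! (i + length es) * h (i + length es) = h (i + length es)" if "i < length fs" for i
      using \<open>h \<in> _\<close> that by (simp add: pmod_def)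
    moreover have "es ! i * h i = h i" if "i < length es" for i
      using \<open>h \<in> _\<close> that by (simp add: pmod_def nth_append split: if_splits)
    moreover have "h i = 0" if "i \<ge> length es + length fs" for i
      using \<open>h \<in> _\<close> that by (simp add: pmod_def)
    ultimately show ?thesis
      by (simp add: dsum_def pmod_def nth_append)
  qed
  show "?f (?g h) = h" if "h \<in> mcarr (pmod (es @ fs))" for h
    using that by (auto simp: dsum_def pmod_def fun_eq_iff)
qed

lemma rmod_iso_pmod_single: "rmod_iso (pmod [e]) (prin e)"
  by (rule rmod_isoI[where f = "\<lambda>f. f 0" and g = "\<lambda>r i. if i = 0 then r else 0"])
     (auto simp: rlinear_def pmod_def prin_def rsub_def fun_eq_iff)

lemma lincomb_pmod:
  "length xs = length rs \<Longrightarrow> lincomb (pmod es) xs rs = (\<lambda>j. \<Sum>i<length xs. (xs ! i) j * rs ! i)"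
proof (induction xs rs rule: list_induct2)
  case Nil
  then show ?case by (simp add: pmod_def)
next
  case (Cons x xs r rs)
  show ?case
    using Cons by (simp add: pmod_def sum.lessThan_Suc_shift del: sum.lessThan_Suc)
qed

definition pvec :: "'r::ring_1 list \<Rightarrow> nat \<Rightarrow> nat \<Rightarrow> 'r" where
  "pvec es i = (\<lambda>j. if j = i then es ! i else 0)"

text \<open>The coordinates of \<open>f\<close> are its coefficients over the generators
  \<open>pvec es i\<close>, because \<open>es ! j\<close> fixes \<open>f j\<close>.\<close>

lemma pvec_sum:
  assumes "f \<in> mcarr (pmod es)"
  shows "(\<Sum>i<length es. pvec es i j * f i) = f j"
proof -
  have "(\<Sum>i<length es. pvec es i j * f i) = (\<Sum>i<length es. if i = j then es ! j * f j else 0)"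
    by (intro sum.cong) (auto simp: pvec_def)
  also have "\<dots> = f j"
    using assms by (auto simp: pmod_def)
  finally show ?thesis .
qed

lemma pvec_in:
  assumes "\<forall>e\<in>set es. e * e = e" "i < length es"
  shows "pvec es i \<in> mcarr (pmod es)"
  using assms by (auto simp: pmod_def pvec_def)

lemma fin_gen_pmod:
  fixes es :: "'r::ring_1 list"
  assumes "\<forall>e\<in>set es. e * e = e"
  shows "fin_gen (pmod es)"
  unfolding fin_gen_def
proof (intro exI conjI ballI)
  let ?xs = "map (pvec es) [0..<length es]"
  show "set ?xs \<subseteq> mcarr (pmod es)"
    using pvec_in[OF assms] by auto
  fix f :: "nat \<Rightarrow> 'r" assume f: "f \<in> mcarr (pmod es)"
  show "length (map f [0..<length es]) = length ?xs"
    by simp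
  show "f = lincomb (pmod es) ?xs (map f [0..<length es])"
    using pvec_sum[OF f] by (simp add: lincomb_pmod fun_eq_iff)
qed

lemma projective_pmod:
  fixes es :: "'r::ring_1 list"
  assumes "\<forall>e\<in>set es. e * e = e"
  shows "projective (pmod es)"
proof -
  let ?n = "length es"
  let ?F = "free_rmod (mcarr (pmod es)) :: ((nat \<Rightarrow> 'r) \<Rightarrow> 'r, 'r) rmod"
  \<comment> \<open>\<open>s\<close> turns \<open>f\<close> into the formal combination of the
    \<open>pvec es i\<close> with coefficients \<open>f i\<close>, and \<open>p\<close> evaluates
    formal combinations. Summing over indices adds the coefficients when several
    \<open>pvec es i\<close> coincide, as for zero entries of \<open>es\<close>.\<close>
  define s :: "(nat \<Rightarrow> 'r) \<Rightarrow> (nat \<Rightarrow> 'r) \<Rightarrow> 'r"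
    where "s = (\<lambda>f m. \<Sum>i<?n. if m = pvec es i then f i else 0)"
  define p :: "((nat \<Rightarrow> 'r) \<Rightarrow> 'r) \<Rightarrow> nat \<Rightarrow> 'r"
    where "p = (\<lambda>g j. \<Sum>m | g m \<noteq> 0. m j * g m)"
  \<comment> \<open>Allows sums with different supports to be taken over one common finite
    set.\<close>
  have p_eq: "p g j = (\<Sum>m\<in>A. m j * g m)" if "finite A" "{m. g m \<noteq> 0} \<subseteq> A" for g j A
    unfolding p_def using that by (intro sum.mono_neutral_left) auto
  have supp_s: "{m. s f m \<noteq> 0} \<subseteq> pvec es ` {..<?n}" for f
  proof
    fix m assume "m \<in> {m. s f m \<noteq> 0}"
    then have "(\<Sum>i<?n. if m = pvec es i then f i else 0) \<noteq> 0"
      by (simp add: s_def)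
    then obtain i where "i \<in> {..<?n}" "(if m = pvec es i then f i else 0) \<noteq> 0"
      by (rule sum.not_neutral_contains_not_neutral)
    then show "m \<in> pvec es ` {..<?n}"
      by (auto split: if_splits)
  qed
  have fin_s: "finite {m. s f m \<noteq> 0}" for f
    using supp_s[of f] by (rule finite_subset) simp
  have "rlinear (pmod es) ?F s"
    unfolding rlinear_def
  proof (intro conjI ballI allI)
    fix f g :: "nat \<Rightarrow> 'r" and r
    have "s f m = 0" if "m \<notin> mcarr (pmod es)" for m
      using that supp_s[of f] pvec_in[OF assms] by auto
    then show "s f \<in> mcarr ?F"
      using fin_s by (simp add: free_rmod_def)
    show "s (madd (pmod es) f g) = madd ?F (s f) (s g)"
      by (auto simp: s_def pmod_def free_rmod_def fun_eq_iff if_distrib simp flip: sum.distrib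
          intro!: sum.cong)
    show "s (msmul (pmod es) f r) = msmul ?F (s f) r"
      by (auto simp: s_def pmod_def free_rmod_def fun_eq_iff sum_distrib_right intro!: sum.cong)
  qed
  moreover have "rlinear ?F (pmod es) p"
    unfolding rlinear_def
  proof (intro conjI ballI allI)
    fix g assume g: "g \<in> mcarr ?F"
    then have fg: "finite {m. g m \<noteq> 0}" and m: "m \<in> mcarr (pmod es)" if "g m \<noteq> 0" for m
      using that by (auto simp: free_rmod_def)
    have "es ! i * p g i = p g i" if "i < ?n" for i
      using m that unfolding p_def sum_distrib_left
      by (intro sum.cong) (auto simp: pmod_def simp flip: mult.assoc)
    moreover have "p g i = 0" if "i \<ge> ?n" for i
    proof -
      have "m i = 0" if "g m \<noteq> 0" for m
        using m[OF that] \<open>i \<ge> ?n\<close> by (simp add: pmod_def)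
      then show ?thesis
        unfolding p_def by (intro sum.neutral) (metis (mono_tags) mem_Collect_eq mult_zero_left)
    qed
    ultimately show "p g \<in> mcarr (pmod es)"
      by (simp add: pmod_def)
  next
    fix g h assume g: "g \<in> mcarr ?F" and h: "h \<in> mcarr ?F"
    let ?A = "{m. g m \<noteq> 0} \<union> {m. h m \<noteq> 0}"
    have A: "finite ?A"
      using g h by (auto simp: free_rmod_def)
    have gh: "{m. g m + h m \<noteq> 0} \<subseteq> ?A"
      by (rule subsetI, rule ccontr) simp
    have "p (\<lambda>i. g i + h i) j = p g j + p h j" for j
      using p_eq[OF A, of g j] p_eq[OF A, of h j] p_eq[OF A gh, of j]
      by (simp add: distrib_left sum.distrib)
    then show "p (madd ?F g h) = madd (pmod es) (p g) (p h)"
      by (simp add: free_rmod_def pmod_def fun_eq_iff)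
  next
    fix g r assume g: "g \<in> mcarr ?F"
    let ?A = "{m. g m \<noteq> 0}"
    have A: "finite ?A"
      using g by (auto simp: free_rmod_def)
    have gr: "{m. g m * r \<noteq> 0} \<subseteq> ?A"
      by auto
    have "p (\<lambda>i. g i * r) j = p g j * r" for j
      using p_eq[OF A, of g j] p_eq[OF A gr, of j]
      by (simp add: sum_distrib_right mult.assoc)
    then show "p (msmul ?F g r) = msmul (pmod es) (p g) r"
      by (simp add: free_rmod_def pmod_def fun_eq_iff)
  qed
  moreover have "p (s f) = f" if f: "f \<in> mcarr (pmod es)" for f
  proof
    fix j
    let ?B = "pvec es ` {..<?n}"
    have "p (s f) j = (\<Sum>m\<in>?B. m j * s f m)"
      using supp_s by (intro p_eq) auto
    also have "\<dots> = (\<Sum>m\<in>?B. \<Sum>i<?n. if m = pvec es i then m j * f i else 0)"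
      unfolding s_def sum_distrib_left by (intro sum.cong) auto
    also have "\<dots> = (\<Sum>i<?n. \<Sum>m\<in>?B. if m = pvec es i then m j * f i else 0)"
      by (rule sum.swap)
    also have "\<dots> = (\<Sum>i<?n. pvec es i j * f i)"
      by (intro sum.cong) auto
    also have "\<dots> = f j"
      by (rule pvec_sum[OF f])
    finally show "p (s f) j = f j" .
  qed
  ultimately show ?thesis
    unfolding projective_def by blast
qed

text \<open>The form in which separativity is applied: concatenation replaces direct sums, so that
  sums of copies stay on the type \<open>nat \<Rightarrow> 'r\<close>.\<close>

lemma separative_pmod:
  fixes es fs :: "'r::ring_1 list"
  assumes "separative TYPE('r)"
    and "\<forall>e\<in>set (es @ fs). e * e = e"
    and "rmod_iso (pmod (es @ es)) (pmod (es @ fs))" "rmod_iso (pmod (es @ fs)) (pmod (fs @ fs))"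
  shows "rmod_iso (pmod es) (pmod fs)"
proof -
  have app: "rmod_iso (dsum (pmod as) (pmod bs)) (dsum (pmod cs) (pmod ds))"
    if "rmod_iso (pmod (as @ bs)) (pmod (cs @ ds))" for as bs cs ds :: "'r list"
    by (rule rmod_iso_trans[OF rmod_iso_trans[OF rmod_iso_pmod_append that]])
       (intro rmod_iso_sym[OF rmod_iso_pmod_append] op_closed_dsum op_closed_pmod)
  have "\<forall>e\<in>set es. e * e = e" "\<forall>e\<in>set fs. e * e = e"
    using assms(2) by simp_all
  then show ?thesis
    using assms(1)[unfolded separative_def, rule_format, of "pmod es" "pmod fs"]
    by (simp add: is_rmod_pmod fin_gen_pmod projective_pmod app assms(3,4))
qed

section \<open>Splitting cyclic projective modules\<close>

text \<open>Projectivity splits the epimorphism \<open>\<pi>\<close> from \<open>R\<close> onto the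
  cyclic module \<open>M\<close>. Following \<open>\<pi>\<close> by the splitting gives a linear
  endomorphism of \<open>R\<close>, hence left multiplication by some \<open>z\<close>, which is
  idempotent with the same kernel as \<open>\<pi>\<close>.\<close>

lemma projective_cyclic_split:
  fixes M :: "('m, 'r::ring_1) rmod" and \<pi> :: "'r \<Rightarrow> 'm"
  assumes "projective M"
    and im: "\<pi> ` UNIV = mcarr M"
    and add: "\<And>r s. \<pi> (r + s) = madd M (\<pi> r) (\<pi> s)"
    and smul: "\<And>r s. \<pi> (r * s) = msmul M (\<pi> r) s"
  obtains z where "z * z = z" "\<And>r. \<pi> r = \<pi> 0 \<longleftrightarrow> z * r = 0"
proof -
  let ?F = "free_rmod (mcarr M) :: ('m \<Rightarrow> 'r, 'r) rmod"
  obtain s p where s: "rlinear M ?F s" and p: "rlinear ?F M p" and ps: "\<And>x. x \<in> mcarr M \<Longrightarrow> p (s x) = x"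
    using assms(1) unfolding projective_def by blast
  define \<delta> :: "'m \<Rightarrow> 'm \<Rightarrow> 'r" where "\<delta> m = (\<lambda>i. if i = m then 1 else 0)" for m
  have \<delta>F: "\<delta> m \<in> mcarr ?F" if "m \<in> mcarr M" for m
    using that by (auto simp: free_rmod_def \<delta>_def)
  have "\<exists>r. \<pi> r = p (\<delta> m)" if "m \<in> mcarr M" for m
    using p \<delta>F[OF that] im by (metis rlinear_def imageE)
  then obtain \<rho> where \<rho>: "\<And>m. m \<in> mcarr M \<Longrightarrow> \<pi> (\<rho> m) = p (\<delta> m)"
    by metis
  \<comment> \<open>\<open>\<sigma>\<close> lifts \<open>p\<close> along \<open>\<pi>\<close>: the
    basis vector \<open>\<delta> m\<close> goes to a chosen preimage \<open>\<rho> m\<close> of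
    \<open>p (\<delta> m)\<close>.\<close>
  define \<sigma> :: "('m \<Rightarrow> 'r) \<Rightarrow> 'r" where "\<sigma> g = (\<Sum>m | g m \<noteq> 0. \<rho> m * g m)" for g
  \<comment> \<open>The zero vector goes to some \<open>\<pi> r\<close>; scaling it by 0 turns this
    into \<open>\<pi> (r * 0)\<close>.\<close>
  have p0: "p (\<lambda>i. 0) = \<pi> 0"
  proof -
    have zF: "(\<lambda>i. 0) \<in> mcarr ?F"
      by (simp add: free_rmod_def)
    then obtain r where "p (\<lambda>i. 0) = \<pi> r"
      using p im by (metis rlinear_def imageE)
    moreover have "p (msmul ?F (\<lambda>i. 0) 0) = msmul M (p (\<lambda>i. 0)) 0"
      using p zF unfolding rlinear_def by blast
    ultimately show ?thesis
      using smul[of r 0] by (simp add: free_rmod_def)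
  qed
  have p_sum: "p g = \<pi> (\<Sum>m\<in>A. \<rho> m * g m)"
    if "finite A" "A \<subseteq> mcarr M" "g \<in> mcarr ?F" "{m. g m \<noteq> 0} \<subseteq> A" for A g
    using that
  proof (induction A arbitrary: g rule: finite_induct)
    case empty
    then have "g = (\<lambda>i. 0)"
      by auto
    then show ?case
      using p0 by simp
  next
    case (insert m A)
    let ?g = "g(m := 0)"
    have g': "?g \<in> mcarr ?F" "{i. ?g i \<noteq> 0} \<subseteq> A"
      using insert.prems by (auto simp: free_rmod_def elim!: rev_finite_subset)
    have dF: "msmul ?F (\<delta> m) (g m) \<in> mcarr ?F"
      using \<delta>F[of m] insert.prems by (auto simp: free_rmod_def elim!: rev_finite_subset)
    have "g = madd ?F (msmul ?F (\<delta> m) (g m)) ?g"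
      by (auto simp: free_rmod_def \<delta>_def)
    then have "p g = p (madd ?F (msmul ?F (\<delta> m) (g m)) ?g)"
      by (rule arg_cong)
    also have "\<dots> = madd M (msmul M (p (\<delta> m)) (g m)) (p ?g)"
      using p g' dF \<delta>F[of m] insert.prems unfolding rlinear_def by simp
    also have "\<dots> = madd M (\<pi> (\<rho> m * g m)) (\<pi> (\<Sum>i\<in>A. \<rho> i * ?g i))"
      using insert.IH[OF _ g'] insert.prems \<rho>[of m] smul by (simp add: fun_upd_def)
    also have "(\<Sum>i\<in>A. \<rho> i * ?g i) = (\<Sum>i\<in>A. \<rho> i * g i)"
      using insert.hyps by (intro sum.cong) auto
    finally show ?case
      using insert.hyps add by simp
  qed
  have p\<sigma>: "p g = \<pi> (\<sigma> g)" if "g \<in> mcarr ?F" for g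
    unfolding \<sigma>_def using that by (intro p_sum) (auto simp: free_rmod_def)
  define z where "z = \<sigma> (s (\<pi> 1))"
  have sF: "s (\<pi> r) \<in> mcarr ?F" for r
    using s im unfolding rlinear_def by blast
  have \<pi>z: "\<pi> z = \<pi> 1"
    using p\<sigma>[OF sF] ps im unfolding z_def by (metis rangeI)
  have s_smul: "s (\<pi> r) = (\<lambda>m. s (\<pi> 1) m * r)" for r
  proof -
    have "s (msmul M (\<pi> 1) r) = msmul ?F (s (\<pi> 1)) r"
      using s im unfolding rlinear_def by blast
    then show ?thesis
      using smul[of 1 r] by (simp add: free_rmod_def)
  qed
  \<comment> \<open>Left multiplication by \<open>z\<close> is \<open>\<sigma>\<close> after
    \<open>s\<close> after \<open>\<pi>\<close>. The support of \<open>s (\<pi> r)\<close> lies in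
    that of \<open>s (\<pi> 1)\<close>, so both sums can run over the latter.\<close>
  have zr: "z * r = \<sigma> (s (\<pi> r))" for r
  proof -
    have "\<sigma> (s (\<pi> r)) = (\<Sum>m | s (\<pi> 1) m \<noteq> 0. \<rho> m * s (\<pi> r) m)"
      unfolding \<sigma>_def using s_smul[of r] sF[of 1]
      by (intro sum.mono_neutral_left) (auto simp: free_rmod_def)
    also have "\<dots> = z * r"
      using s_smul[of r] by (simp add: z_def \<sigma>_def sum_distrib_right mult.assoc)
    finally show ?thesis ..
  qed
  have ker: "\<pi> r = \<pi> 0 \<longleftrightarrow> z * r = 0" for r
  proof
    assume "\<pi> r = \<pi> 0"
    then show "z * r = 0"
      using zr[of r] zr[of 0] by simp
  next
    assume "z * r = 0"
    then show "\<pi> r = \<pi> 0"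
      using smul[of z r] smul[of 1 r] \<pi>z by simp
  qed
  \<comment> \<open>As \<open>\<pi> z = \<pi> 1\<close>, the images of \<open>1 - z\<close> and
    \<open>z - z\<close> are the same sum in \<open>M\<close>; \<open>ker\<close> then gives
    \<open>z * (1 - z) = 0\<close>.\<close>
  have "\<pi> (1 - z) = \<pi> 0"
    using add[of 1 "z * (- 1)"] add[of z "z * (- 1)"] smul[of z "- 1"] \<pi>z by simp
  then have "z * z = z"
    using ker[of "1 - z"] by (simp add: algebra_simps)
  with ker show thesis
    using that by blast
qed

text \<open>The quotient is cyclic, generated by the coset of \<open>c\<close>, and
  \<open>c * r\<close> lies in \<open>K\<close> exactly when that generator times \<open>r\<close>
  is zero.\<close>

lemma projective_quot_split:
  fixes c :: "'r::ring_1"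
  assumes "projective (quot_rmod {c * x | x. True} K)"
    and K0: "0 \<in> K" and Kadd: "\<And>x y. x \<in> K \<Longrightarrow> y \<in> K \<Longrightarrow> x + y \<in> K"
    and Kmul: "\<And>x r. x \<in> K \<Longrightarrow> x * r \<in> K"
  obtains z where "z * z = z" "\<And>r. c * r \<in> K \<longleftrightarrow> z * r = 0"
proof -
  let ?M = "quot_rmod {c * x | x. True} K"
  let ?co = "\<lambda>x. (\<lambda>k. x + k) ` K"
  have Kneg: "- x \<in> K" if "x \<in> K" for x
    using Kmul[OF that, of "- 1"] by simp
  have mem: "y \<in> ?co x \<longleftrightarrow> y - x \<in> K" for x y
    by (force simp: image_iff algebra_simps)
  have co_add: "?co (x + y) = {u + v | u v. u \<in> ?co x \<and> v \<in> ?co y}" for x y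
  proof (intro set_eqI iffI)
    fix t assume "t \<in> ?co (x + y)"
    then obtain k where "k \<in> K" "t = x + y + k" by auto
    then have "t = x + (y + k)" "x \<in> ?co x" "y + k \<in> ?co y"
      using K0 by (auto simp: mem algebra_simps)
    then show "t \<in> {u + v | u v. u \<in> ?co x \<and> v \<in> ?co y}" by blast
  next
    fix t assume "t \<in> {u + v | u v. u \<in> ?co x \<and> v \<in> ?co y}"
    then obtain u v where "t = u + v" "u - x \<in> K" "v - y \<in> K"
      unfolding mem by blast
    moreover from this have "(u - x) + (v - y) \<in> K"
      using Kadd by blast
    ultimately show "t \<in> ?co (x + y)"
      unfolding mem by (simp add: algebra_simps)
  qed
  \<comment> \<open>Multiplying a coset elementwise by \<open>r\<close> may give only part of a
    coset; adding \<open>K\<close> fills it up.\<close>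
  have co_smul: "?co (x * r) = {u * r + k | u k. u \<in> ?co x \<and> k \<in> K}" for x r
  proof (intro set_eqI iffI)
    fix t assume "t \<in> ?co (x * r)"
    moreover have "x \<in> ?co x"
      using K0 by (simp add: mem)
    ultimately show "t \<in> {u * r + k | u k. u \<in> ?co x \<and> k \<in> K}" by blast
  next
    fix t assume "t \<in> {u * r + k | u k. u \<in> ?co x \<and> k \<in> K}"
    then obtain u k where "t = u * r + k" "u - x \<in> K" "k \<in> K"
      unfolding mem by blast
    moreover from this have "(u - x) * r + k \<in> K"
      using Kadd Kmul by blast
    ultimately show "t \<in> ?co (x * r)"
      unfolding mem by (simp add: algebra_simps)
  qed
  have co_eq: "?co x = ?co 0 \<longleftrightarrow> x \<in> K" for x
  proof
    assume "?co x = ?co 0"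
    moreover have "x \<in> ?co x"
      using K0 by (simp add: mem)
    ultimately show "x \<in> K"
      using mem[of x 0] by simp
  next
    assume x: "x \<in> K"
    have "y - x \<in> K \<longleftrightarrow> y \<in> K" for y
      using Kadd[OF x, of "y - x"] Kadd[OF _ Kneg[OF x], of y] by auto
    then show "?co x = ?co 0"
      by (intro set_eqI) (simp add: mem)
  qed
  obtain z where "z * z = z" "\<And>r. ?co (c * r) = ?co (c * 0) \<longleftrightarrow> z * r = 0"
  proof (rule projective_cyclic_split[OF assms(1), of "\<lambda>r. ?co (c * r)"])
    show "(\<lambda>r. ?co (c * r)) ` UNIV = mcarr ?M"
      by (auto simp: quot_rmod_def)
    show "?co (c * (r + s)) = madd ?M (?co (c * r)) (?co (c * s))" for r s
      using co_add[of "c * r" "c * s"] by (simp add: quot_rmod_def distrib_left)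
    show "?co (c * (r * s)) = msmul ?M (?co (c * r)) s" for r s
      using co_smul[of "c * r" s] by (simp add: quot_rmod_def mult.assoc)
  qed blast
  with co_eq that show thesis
    by simp
qed

section \<open>Separative cancellation\<close>

text \<open>Here \<open>R a b c d\<close> stands for \<open>a x + b w = c x + d w\<close> in a commutative monoid.\<close>

lemma separative_descent:
  fixes R :: "nat \<Rightarrow> nat \<Rightarrow> nat \<Rightarrow> nat \<Rightarrow> bool"
  assumes add: "\<And>a b c d i j. R a b c d \<Longrightarrow> R (a + i) (b + j) (c + i) (d + j)"
    and sep: "\<And>a b c d. R (a + a) (b + b) (a + c) (b + d) \<Longrightarrow>
      R (a + c) (b + d) (c + c) (d + d) \<Longrightarrow> R a b c d"
    and "R (Suc n) 0 n 1"
  shows "R 2 0 1 1"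
  using assms(3)
proof (induction n rule: less_induct)
  case (less n)
  consider "n = 0" | "n = 1" | m where "n = Suc (Suc m)"
    by (metis One_nat_def not0_implies_Suc)
  then show ?case
  proof cases
    case 1
    then show ?thesis
      using add[of 1 0 0 1 1 0] less.prems by (simp add: numeral_2_eq_2)
  next
    case 2
    then show ?thesis
      using less.prems by (simp add: numeral_2_eq_2)
  next
    case (3 m)
    \<comment> \<open>Apply separativity to \<open>A = n x\<close> and
      \<open>B = (m + 1) x + w\<close>, where \<open>n = m + 2\<close>. Adding
      \<open>(m + 1) x\<close> to the given relation yields \<open>A + A = A + B\<close>; adding
      \<open>m x + w\<close> yields \<open>A + B = B + B\<close>.\<close>
    have "R n 0 (Suc m) 1"
    proof (rule sep)
      show "R (n + n) (0 + 0) (n + Suc m) (0 + 1)"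
        using add[OF less.prems, of "Suc m" 0] 3 by (simp add: ac_simps)
      show "R (n + Suc m) (0 + 1) (Suc m + Suc m) (1 + 1)"
        using add[OF less.prems, of m 1] 3 by (simp add: ac_simps)
    qed
    then show ?thesis
      using less.IH[of "Suc m"] 3 by simp
  qed
qed

text \<open>Descent gives \<open>2 x = x + w\<close> and, with \<open>x\<close> and \<open>w\<close>
  exchanged, \<open>2 w = x + w\<close>; separativity then gives \<open>x = w\<close>.\<close>

lemma separative_cancel_monoid:
  fixes R :: "nat \<Rightarrow> nat \<Rightarrow> nat \<Rightarrow> nat \<Rightarrow> bool"
  assumes sym: "\<And>a b c d. R a b c d \<Longrightarrow> R c d a b"
    and add: "\<And>a b c d i j. R a b c d \<Longrightarrow> R (a + i) (b + j) (c + i) (d + j)"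
    and sep: "\<And>a b c d. R (a + a) (b + b) (a + c) (b + d) \<Longrightarrow>
      R (a + c) (b + d) (c + c) (d + d) \<Longrightarrow> R a b c d"
    and x: "R (Suc n) 0 n 1" and w: "R 0 (Suc m) 1 m"
  shows "R 1 0 0 1"
proof (rule sep)
  show "R (1 + 1) (0 + 0) (1 + 0) (0 + 1)"
    using separative_descent[of R, OF add sep x] by (simp add: numeral_2_eq_2)
  have "R 0 2 1 1"
    by (rule separative_descent[of "\<lambda>a b c d. R b a d c", OF add sep w])
  then show "R (1 + 0) (0 + 1) (0 + 0) (1 + 1)"
    using sym by (simp add: numeral_2_eq_2)
qed

text \<open>The module representing \<open>k x + l w\<close>; isomorphism of such modules is the
  relation \<open>R\<close> of the monoid argument.\<close>

definition copies :: "'r::ring_1 \<Rightarrow> 'r \<Rightarrow> nat \<Rightarrow> nat \<Rightarrow> (nat \<Rightarrow> 'r, 'r) rmod" where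
  "copies x w k l = pmod (replicate k x @ replicate l w)"

lemma op_closed_copies: "op_closed (copies x w k l)"
  by (simp add: copies_def op_closed_pmod)

lemma rmod_iso_pmod_swap: "rmod_iso (pmod (es @ fs)) (pmod (fs @ es))"
proof -
  have "rmod_iso (pmod (es @ fs)) (dsum (pmod es) (pmod fs))"
    by (intro rmod_iso_sym[OF rmod_iso_pmod_append] op_closed_dsum op_closed_pmod)
  also have "rmod_iso \<dots> (dsum (pmod fs) (pmod es))"
    by (rule rmod_iso_dsum_comm)
  also have "rmod_iso \<dots> (pmod (fs @ es))"
    by (rule rmod_iso_pmod_append)
  finally show ?thesis .
qed

lemma rmod_iso_pmod_cong:
  assumes "rmod_iso (pmod es) (pmod es')" "rmod_iso (pmod fs) (pmod fs')"
  shows "rmod_iso (pmod (es @ fs)) (pmod (es' @ fs'))"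
proof -
  have "rmod_iso (pmod (es @ fs)) (dsum (pmod es) (pmod fs))"
    by (intro rmod_iso_sym[OF rmod_iso_pmod_append] op_closed_dsum op_closed_pmod)
  also have "rmod_iso \<dots> (dsum (pmod es') (pmod fs'))"
    by (rule rmod_iso_dsum[OF assms])
  also have "rmod_iso \<dots> (pmod (es' @ fs'))"
    by (rule rmod_iso_pmod_append)
  finally show ?thesis .
qed

lemma rmod_iso_copies_add:
  "rmod_iso (pmod ((replicate k x @ replicate l w) @ (replicate k' x @ replicate l' w)))
     (copies x w (k + k') (l + l'))"
proof -
  have "rmod_iso (pmod (replicate k x @ (replicate l w @ replicate k' x) @ replicate l' w))
     (pmod (replicate k x @ (replicate k' x @ replicate l w) @ replicate l' w))"
    by (intro rmod_iso_pmod_cong rmod_iso_refl rmod_iso_pmod_swap)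
  then show ?thesis
    by (simp add: copies_def replicate_add)
qed

lemma rmod_iso_copies_dsum:
  "rmod_iso (dsum (copies x w k l) (copies x w k' l')) (copies x w (k + k') (l + l'))"
  unfolding copies_def[of x w k l] copies_def[of x w k' l']
  by (rule rmod_iso_trans[OF rmod_iso_pmod_append rmod_iso_copies_add])

text \<open>Adding \<open>T\<close> to both sides of the given isomorphism turns the cancellable
  part \<open>V\<close> into a sum of copies of \<open>prin x\<close> and
  \<open>prin w\<close>.\<close>

lemma rmod_iso_copies_Suc:
  assumes V: "op_closed V" and T: "op_closed T"
    and iso: "rmod_iso (dsum (prin x) V) (dsum (prin w) V)"
    and VT: "rmod_iso (dsum V T) (copies x w n m)"
  shows "rmod_iso (copies x w (Suc n) m) (copies x w n (Suc m))"
proof -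
  note closed = op_closed_dsum V T op_closed_prin op_closed_copies
  have x: "rmod_iso (copies x w 1 0) (prin x)" and w: "rmod_iso (copies x w 0 1) (prin w)"
    using rmod_iso_pmod_single by (simp_all add: copies_def)
  have "rmod_iso (copies x w (Suc n) m) (dsum (copies x w 1 0) (copies x w n m))"
    using rmod_iso_sym[OF rmod_iso_copies_dsum[of x w 1 0 n m]] by (simp add: closed)
  also have "rmod_iso \<dots> (dsum (prin x) (dsum V T))"
    by (intro rmod_iso_dsum x rmod_iso_sym[OF VT] closed)
  also have "rmod_iso \<dots> (dsum (dsum (prin x) V) T)"
    by (rule rmod_iso_dsum_assoc')
  also have "rmod_iso \<dots> (dsum (dsum (prin w) V) T)"
    by (intro rmod_iso_dsum iso rmod_iso_refl)
  also have "rmod_iso \<dots> (dsum (prin w) (dsum V T))"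
    by (rule rmod_iso_dsum_assoc)
  also have "rmod_iso \<dots> (dsum (copies x w 0 1) (copies x w n m))"
    by (intro rmod_iso_dsum rmod_iso_sym[OF w] VT closed)
  also have "rmod_iso \<dots> (copies x w n (Suc m))"
    using rmod_iso_copies_dsum[of x w 0 1 n m] by simp
  finally show ?thesis .
qed

lemma separative_cancel:
  fixes x w :: "'r::ring_1"
  assumes sep: "separative TYPE('r)"
    and idem: "x * x = x" "w * w = w"
    and closed: "op_closed V" "op_closed T" "op_closed T'"
    and iso: "rmod_iso (dsum (prin x) V) (dsum (prin w) V)"
    and VT: "rmod_iso (dsum V T) (copies x w n 0)"
    and VT': "rmod_iso (dsum V T') (copies x w 0 m)"
  shows "rmod_iso (prin x) (prin w)"
proof -
  let ?R = "\<lambda>a b c d. rmod_iso (copies x w a b) (copies x w c d)"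
  have "?R 1 0 0 1"
  proof (rule separative_cancel_monoid[of ?R])
    show "?R c d a b" if "?R a b c d" for a b c d
      by (rule rmod_iso_sym[OF that op_closed_copies])
    show "?R (a + i) (b + j) (c + i) (d + j)" if "?R a b c d" for a b c d i j
    proof -
      have "rmod_iso (copies x w (a + i) (b + j)) (dsum (copies x w a b) (copies x w i j))"
        by (intro rmod_iso_sym[OF rmod_iso_copies_dsum] op_closed_dsum op_closed_copies)
      also have "rmod_iso \<dots> (dsum (copies x w c d) (copies x w i j))"
        by (intro rmod_iso_dsum that rmod_iso_refl)
      also have "rmod_iso \<dots> (copies x w (c + i) (d + j))"
        by (rule rmod_iso_copies_dsum)
      finally show ?thesis .
    qed
    show "?R a b c d" if 1: "?R (a + a) (b + b) (a + c) (b + d)"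
      and 2: "?R (a + c) (b + d) (c + c) (d + d)" for a b c d
    proof -
      let ?es = "replicate a x @ replicate b w" and ?fs = "replicate c x @ replicate d w"
      have eq: "rmod_iso (pmod ((replicate k x @ replicate l w) @ (replicate k' x @ replicate l' w)))
          (pmod ((replicate i x @ replicate j w) @ (replicate i' x @ replicate j' w)))"
        if "?R (k + k') (l + l') (i + i') (j + j')" for k l k' l' i j i' j'
        by (rule rmod_iso_trans[OF rmod_iso_trans[OF rmod_iso_copies_add that]
              rmod_iso_sym[OF rmod_iso_copies_add op_closed_pmod]])
      have "\<forall>e\<in>set (?es @ ?fs). e * e = e"
        using idem by auto
      then show ?thesis
        unfolding copies_def by (rule separative_pmod[OF sep]) (use 1 2 in \<open>intro eq; simp\<close>)+
    qed
    show "?R (Suc n) 0 n 1"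
      using rmod_iso_copies_Suc[OF closed(1,2) iso VT] by simp
    show "?R 0 (Suc m) 1 m"
      using rmod_iso_sym[OF rmod_iso_copies_Suc[OF closed(1,3) iso VT'] op_closed_copies] by simp
  qed
  then have "rmod_iso (pmod [x]) (pmod [w])"
    by (simp add: copies_def)
  then have "rmod_iso (prin x) (pmod [w])"
    by (rule rmod_iso_trans[OF rmod_iso_sym[OF rmod_iso_pmod_single op_closed_pmod]])
  then show ?thesis
    by (rule rmod_iso_trans) (rule rmod_iso_pmod_single)
qed

text \<open>A linear map out of \<open>xR\<close> is left multiplication by the image of
  \<open>x\<close>, so \<open>\<alpha>\<close> and \<open>\<beta>\<close> are the images of
  \<open>x\<close> and \<open>w\<close> under the two inverse isomorphisms.\<close>

lemma rmod_iso_prinE: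
  fixes x w :: "'r::ring_1"
  assumes "rmod_iso (prin x) (prin w)" "x * x = x" "w * w = w"
  obtains \<alpha> \<beta> where "w * \<alpha> = \<alpha>" "\<alpha> * x = \<alpha>" "x * \<beta> = \<beta>" "\<beta> * w = \<beta>" "\<beta> * \<alpha> = x" "\<alpha> * \<beta> = w"
proof -
  obtain f g where f: "rlinear (prin x) (prin w) f" and g: "rlinear (prin w) (prin x) g"
    and gf: "\<And>r. r \<in> mcarr (prin x) \<Longrightarrow> g (f r) = r" and fg: "\<And>r. r \<in> mcarr (prin w) \<Longrightarrow> f (g r) = r"
    using rmod_isoE[OF assms(1) op_closed_prin] by blast
  have car: "mcarr (prin e) = {r. e * r = r}" and mul: "msmul (prin e) r s = r * s" for e r s :: 'r
    by (simp_all add: prin_def rsub_def)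
  have fmul: "f (r * s) = f r * s" "w * f r = f r" if "x * r = r" for r s
    using f that by (simp_all add: rlinear_def car mul)
  have gmul: "g (r * s) = g r * s" "x * g r = g r" if "w * r = r" for r s
    using g that by (simp_all add: rlinear_def car mul)
  show thesis
  proof (rule that[of "f x" "g w"])
    show "w * f x = f x" "f x * x = f x" "x * g w = g w" "g w * w = g w"
      using fmul[OF assms(2)] gmul[OF assms(3)] assms(2,3) by metis+
    show "g w * f x = x"
      using gmul(1)[OF assms(3), of "f x"] fmul(2)[OF assms(2)] gf assms(2) by (simp add: car)
    show "f x * g w = w"
      using fmul(1)[OF assms(2), of "g w"] gmul(2)[OF assms(3)] fg assms(3) by (simp add: car)
  qed
qed

section \<open>Idempotents in the trace ideal of an idempotent\<close>

text \<open>The two-sided ideal \<open>RxR\<close>; for idempotent \<open>x\<close> it is the trace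
  ideal of the projective module \<open>xR\<close>.\<close>

inductive_set trace_ideal :: "'r::ring_1 \<Rightarrow> 'r set" for x where
  zero: "0 \<in> trace_ideal x"
| step: "s \<in> trace_ideal x \<Longrightarrow> s + q * x * p \<in> trace_ideal x"

lemma trace_ideal_add: "s \<in> trace_ideal x \<Longrightarrow> t \<in> trace_ideal x \<Longrightarrow> t + s \<in> trace_ideal x"
  by (induction s rule: trace_ideal.induct) (auto simp flip: add.assoc intro: trace_ideal.step)

lemma trace_ideal_mult: "s \<in> trace_ideal x \<Longrightarrow> b * s * c \<in> trace_ideal x"
proof (induction s rule: trace_ideal.induct)
  case zero
  then show ?case
    by (simp add: trace_ideal.zero)
next
  case (step s q p)
  then show ?case
    using trace_ideal.step[OF step.IH, of "b * q" "p * c"] by (simp add: algebra_simps)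
qed

lemma two_sided_ideal_trace_ideal: "two_sided_ideal (trace_ideal x)"
proof -
  have "- s \<in> trace_ideal x" if "s \<in> trace_ideal x" for s
    using trace_ideal_mult[OF that, of "- 1" 1] by simp
  moreover have "r * s \<in> trace_ideal x" "s * r \<in> trace_ideal x" if "s \<in> trace_ideal x" for r s
    using trace_ideal_mult[OF that, of r 1] trace_ideal_mult[OF that, of 1 r] by simp_all
  ultimately show ?thesis
    by (simp add: two_sided_ideal_def trace_ideal.zero trace_ideal_add)
qed

lemma gen_ideal_subset_trace_ideal:
  assumes "\<And>s. s \<in> S \<Longrightarrow> s = x * s \<or> s = s * x"
  shows "gen_ideal S \<subseteq> trace_ideal x"
proof -
  have "s \<in> trace_ideal x" if "s \<in> S" for s
    using assms[OF that] trace_ideal.step[OF trace_ideal.zero, of 1 x s]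
      trace_ideal.step[OF trace_ideal.zero, of s x 1] by auto
  then show ?thesis
    unfolding gen_ideal_def using two_sided_ideal_trace_ideal by blast
qed

lemma gen_ideal_mult:
  assumes "s \<in> S"
  shows "s * r \<in> gen_ideal S"
  using assms unfolding gen_ideal_def two_sided_ideal_def by blast

lemma trace_ideal_sum:
  assumes "s \<in> trace_ideal x"
  obtains n q p where "s = (\<Sum>i<(n::nat). q i * x * p i)"
  using assms
proof (induction s arbitrary: thesis rule: trace_ideal.induct)
  case zero
  then show ?case
    by (metis lessThan_0 sum.empty)
next
  case (step s q p)
  obtain n q' p' where s: "s = (\<Sum>i<(n::nat). q' i * x * p' i)"
    using step.IH by blast
  have "s + q * x * p = (\<Sum>i<Suc n. (q'(n := q)) i * x * (p'(n := p)) i)"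
    by (simp add: s)
  then show ?case
    by (rule step.prems)
qed

text \<open>If \<open>e\<close> is the sum of the \<open>q i * x * p i\<close>, the
  \<open>p i\<close> give a map from \<open>eR\<close> to the sum of \<open>n\<close> copies of
  \<open>xR\<close>, the \<open>q i\<close> give a map back, and the composite is the identity of
  \<open>eR\<close>. The complement \<open>T\<close> is the kernel of the map back.\<close>

lemma trace_ideal_summand:
  fixes e x :: "'r::ring_1"
  assumes e: "e * e = e" and x: "x * x = x" and "e \<in> trace_ideal x"
  obtains n and T :: "(nat \<Rightarrow> 'r, 'r) rmod"
  where "op_closed T" "rmod_iso (dsum (prin e) T) (pmod (replicate n x))"
proof -
  obtain n q p where sum: "e = (\<Sum>i<(n::nat). q i * x * p i)"
    using trace_ideal_sum[OF assms(3)] .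
  define \<alpha> where "\<alpha> r = (\<lambda>i. if i < n then x * p i * r else 0)" for r
  define \<beta> where "\<beta> f = e * (\<Sum>i<n. q i * f i)" for f
  let ?M = "pmod (replicate n x)"
  let ?T = "?M\<lparr>mcarr := {f \<in> mcarr ?M. \<beta> f = 0}\<rparr>"
  have \<beta>_add: "\<beta> (\<lambda>i. f i + g i) = \<beta> f + \<beta> g" for f g
    by (simp add: \<beta>_def distrib_left sum.distrib)
  have \<beta>_mult: "\<beta> (\<lambda>i. f i * r) = \<beta> f * r" for f r
    by (simp add: \<beta>_def sum_distrib_right mult.assoc)
  have \<alpha>_in: "\<alpha> r \<in> mcarr ?M" for r
    using x by (simp add: \<alpha>_def pmod_def flip: mult.assoc)
  have \<beta>\<alpha>: "\<beta> (\<alpha> r) = e * r" for r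
  proof -
    have "(\<Sum>i<n. q i * \<alpha> r i) = (\<Sum>i<n. q i * x * p i) * r"
      unfolding sum_distrib_right by (rule sum.cong) (simp_all add: \<alpha>_def mult.assoc)
    then show ?thesis
      using e by (simp add: \<beta>_def flip: sum mult.assoc)
  qed
  have M: "madd ?M f g = (\<lambda>i. f i + g i)" "msmul ?M f r = (\<lambda>i. f i * r)" for f g r
    by (simp_all add: pmod_def)
  have closed: "op_closed ?M"
    by (rule op_closed_pmod)
  show thesis
  proof (rule that)
    show "op_closed ?T"
      using closed \<beta>_add \<beta>_mult by (simp add: op_closed_def M)
    show "rmod_iso (dsum (prin e) ?T) ?M"
    proof (rule rmod_isoI[where f = "\<lambda>(r, f) i. \<alpha> r i + f i" and g = "\<lambda>f. (\<beta> f, \<lambda>i. f i - \<alpha> (\<beta> f) i)"])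
      show "rlinear (dsum (prin e) ?T) ?M (\<lambda>(r, f) i. \<alpha> r i + f i)"
        using \<alpha>_in closed unfolding op_closed_def
        by (auto simp: rlinear_def dsum_def M prin_def rsub_def \<alpha>_def algebra_simps fun_eq_iff)
      show "(\<lambda>f. (\<beta> f, \<lambda>i. f i - \<alpha> (\<beta> f) i)) ((\<lambda>(r, f) i. \<alpha> r i + f i) y) = y"
        if "y \<in> mcarr (dsum (prin e) ?T)" for y
        using that by (auto simp: dsum_def prin_def rsub_def \<beta>_add \<beta>\<alpha>)
      show "(\<beta> f, \<lambda>i. f i - \<alpha> (\<beta> f) i) \<in> mcarr (dsum (prin e) ?T)" if "f \<in> mcarr ?M" for f
      proof -
        have e\<beta>: "e * \<beta> f = \<beta> f"
          using e by (simp add: \<beta>_def flip: mult.assoc)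
        \<comment> \<open>The difference is written with the scalar \<open>- 1\<close> so that
          closure of \<open>?M\<close> applies.\<close>
        have "(\<lambda>i. f i + \<alpha> (\<beta> f) i * - 1) \<in> mcarr ?M"
          using closed that \<alpha>_in[of "\<beta> f"] unfolding op_closed_def M by fast
        moreover have "\<beta> (\<lambda>i. f i + \<alpha> (\<beta> f) i * - 1) = 0"
          unfolding \<beta>_add \<beta>_mult \<beta>\<alpha> by (simp add: e\<beta>)
        ultimately show ?thesis
          using e\<beta> by (simp add: dsum_def prin_def rsub_def)
      qed
    qed auto
  qed
qed

section \<open>A Peirce decomposition adapted to image and kernel\<close>

text \<open>Extends a product rule to right-nested products, the normal form under
  \<open>algebra_simps\<close>.\<close>

lemma mult_rewrite: "u * v = (t :: 'r::ring_1) \<Longrightarrow> u * (v * r) = t * r"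
  by (simp flip: mult.assoc)

text \<open>The images of \<open>x + y\<close> and \<open>x + z\<close> are \<open>aR\<close> and \<open>r(a)\<close>.\<close>

lemma image_kernel_decomposition:
  fixes a :: "'r::ring_1"
  assumes reg: "regular a"
    and g: "\<And>r. a * a * r = 0 \<longleftrightarrow> g * r = 0" "g * g = g"
    and c: "\<And>r. (\<exists>s k. r = a * s + k \<and> a * k = 0) \<longleftrightarrow> c * r = 0" "c * c = c"
  obtains x y z w s where
    "x * x = x" "y * y = y" "z * z = z" "w * w = w"
    "x * y = 0" "x * z = 0" "x * w = 0" "y * x = 0" "y * z = 0" "y * w = 0"
    "z * x = 0" "z * y = 0" "z * w = 0" "w * x = 0" "w * y = 0" "w * z = 0"
    "x + y + z + w = 1"
    "a * s = x + y" "s * (x + y) = s" "(x + y) * a = a" "a * x = 0" "a * z = 0"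
    "\<And>k. a * k = 0 \<Longrightarrow> x * k + z * k = k"
proof -
  obtain b' where b': "a = a * b' * a"
    using reg unfolding regular_def by blast
  \<comment> \<open>Makes the inner inverse reflexive, \<open>b * a * b = b\<close>.\<close>
  define b where "b = b' * a * b'"
  have aba: "a * b * a = a" and bab: "b * a * b = b"
    unfolding b_def using b' by (metis mult.assoc)+
  define p where "p = a * b"
  have pp: "p * p = p" and pa: "p * a = a" and bp: "b * p = b"
    using aba bab by (simp_all add: p_def flip: mult.assoc)
  define x0 where "x0 = a * (1 - g) * b"
  have ax: "a * x0 = 0"
    using g(1)[of "(1 - g) * b"] g(2) by (simp add: x0_def algebra_simps mult_rewrite[OF g(2)])
  have xp: "x0 * p = x0"
    by (simp add: x0_def bp mult.assoc)
  have px: "p * x0 = x0"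
    by (simp add: x0_def pa flip: mult.assoc)
  have x_fix: "x0 * r = r" if "p * r = r" "a * r = 0" for r
  proof -
    have "g * (b * r) = 0"
      using that g(1)[of "b * r"] by (simp add: p_def mult.assoc)
    then show ?thesis
      using that(1) by (simp add: x0_def p_def algebra_simps)
  qed
  have xx: "x0 * x0 = x0"
    using x_fix[OF px ax] .
  \<comment> \<open>\<open>h\<close> projects onto \<open>aR + r(a)\<close>; below, \<open>q\<close>
    projects onto a complement of \<open>aR\<close> in it.\<close>
  define h where "h = 1 - c"
  have h_fix: "h * r = r \<longleftrightarrow> (\<exists>s k. r = a * s + k \<and> a * k = 0)" for r
    unfolding c(1) by (simp add: h_def algebra_simps)
  have hh: "h * h = h"
    using c(2) by (simp add: h_def algebra_simps)
  have hp: "h * p = p"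
    unfolding h_fix by (rule exI[of _ b], rule exI[of _ 0]) (simp add: p_def)
  define q where "q = h - p * h"
  note hps = hh hp pp hh[THEN mult_rewrite] hp[THEN mult_rewrite] pp[THEN mult_rewrite]
  have qq: "q * q = q" and pq: "p * q = 0" and qp: "q * p = 0" and hq: "h * q = q"
    by (simp_all add: q_def algebra_simps hps)
  have q_fix: "q * r = r - p * r" if "h * r = r" for r
    using that by (simp add: q_def left_diff_distrib mult.assoc)
  have qa: "q * a = 0"
    using pa qp by (metis mult.assoc mult_zero_left)
  \<comment> \<open>\<open>q\<close> may have image outside \<open>r(a)\<close>. Splitting
    \<open>q\<close> along \<open>aR + r(a)\<close> gives \<open>k\<close> with
    \<open>a * k = 0\<close>, and \<open>z = k * q\<close> carries the image of \<open>q\<close>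
    isomorphically into \<open>r(a)\<close>.\<close>
  obtain s k where sk: "q = a * s + k" and ak: "a * k = 0"
    using hq unfolding h_fix by blast
  have qkq: "q * k * q = q"
  proof -
    have "q * k = q * q - q * a * s"
      by (subst (2) sk) (simp add: distrib_left mult.assoc)
    then show ?thesis
      using qq qa by simp
  qed
  define z where "z = k * q"
  have zz: "z * z = z" and qz: "q * z = q"
    using qkq by (simp_all add: z_def mult.assoc)
  have zq: "z * q = z"
    by (simp add: z_def mult.assoc qq)
  have az: "a * z = 0"
    by (simp add: z_def ak flip: mult.assoc)
  have zp: "z * p = 0"
    by (simp add: z_def qp mult.assoc)
  have ker_h: "h * r = r" if "a * r = 0" for r
    unfolding h_fix using that by (metis add.left_neutral mult_zero_right)
  have pz: "p * z = z - q"
    using q_fix[OF ker_h[OF az]] qz by (simp add: algebra_simps)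
  have xq: "x0 * q = 0" and qx: "q * x0 = 0" and zx: "z * x0 = 0"
    using xp px pq qp zp by (metis mult.assoc mult_zero_left mult_zero_right)+
  have za: "z * a = 0"
    using pa zp by (metis mult.assoc mult_zero_left)
  have bq: "b * q = 0"
    using bp pq by (metis mult.assoc mult_zero_right)
  note tab = pp pq pz px qp qq qz qx zp zq zz zx xp xq xx pa ax az qa za bp bq p_def[symmetric]
  note tabs = tab tab[THEN mult_rewrite]
  \<comment> \<open>Removing \<open>z * r\<close> from \<open>r\<close> leaves an element of
    \<open>r(a)\<close> killed by \<open>q\<close>, hence lying in \<open>aR\<close>, hence fixed by
    \<open>x0\<close>.\<close>
  have ker: "(x0 - x0 * z) * r + z * r = r" if "a * r = 0" for r
  proof -
    let ?r = "r - z * r"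
    have "a * ?r = 0"
      using that by (simp add: algebra_simps tabs)
    moreover have "q * ?r = 0"
      by (simp add: algebra_simps tabs)
    ultimately have "x0 * ?r = ?r"
      using q_fix[OF ker_h] by (intro x_fix) simp_all
    then show ?thesis
      by (simp add: algebra_simps)
  qed
  show thesis
    \<comment> \<open>The right factor \<open>1 - z\<close> makes \<open>x0\<close> and
      \<open>p\<close> vanish on \<open>z\<close>: the idempotents are
      \<open>x = x0 * (1 - z)\<close> and \<open>y = p * (1 - z) - x\<close>, since
      \<open>p * z = z - q\<close>.\<close>
    by (rule that[of "x0 - x0 * z" "p - z + q - x0 + x0 * z" z "1 - p - q" "b * (1 - z)"];
        (rule ker, assumption)?; simp add: algebra_simps tabs)
qed

section \<open>Special cleanness from an isomorphism of corner modules\<close>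

text \<open>The kernel of \<open>e\<close> complements \<open>r(a)\<close>. On that kernel
  \<open>a - e\<close> acts as \<open>a\<close>, mapping it isomorphically onto \<open>aR\<close>;
  on \<open>r(a)\<close> it acts as \<open>- e\<close>, mapping it isomorphically onto
  \<open>eR\<close>. As \<open>R\<close> is the direct sum of \<open>aR\<close> and
  \<open>eR\<close>, \<open>a - e\<close> is a unit.\<close>

lemma special_clean_of_iso:
  fixes a :: "'r::ring_1"
  assumes idem: "x * x = x" "y * y = y" "z * z = z" "w * w = w"
    and orth: "x * y = 0" "x * z = 0" "x * w = 0" "y * x = 0" "y * z = 0" "y * w = 0"
      "z * x = 0" "z * y = 0" "z * w = 0" "w * x = 0" "w * y = 0" "w * z = 0"
    and sum: "x + y + z + w = 1"
    and a: "a * s = x + y" "s * (x + y) = s" "(x + y) * a = a" "a * x = 0" "a * z = 0"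
      "\<And>k. a * k = 0 \<Longrightarrow> x * k + z * k = k"
    and iso: "w * \<alpha> = \<alpha>" "\<alpha> * x = \<alpha>" "x * \<beta> = \<beta>" "\<beta> * w = \<beta>" "\<beta> * \<alpha> = x" "\<alpha> * \<beta> = w"
  shows "\<exists>e. e * e = e \<and> is_unit (a - e) \<and> {a * t | t. True} \<inter> {e * t | t. True} = {0}"
proof -
  define e where "e = z + w - \<alpha>"
  \<comment> \<open>\<open>d\<close> is the projection onto the kernel of \<open>e\<close> along
    \<open>r(a)\<close>. In \<open>v\<close>, the term \<open>d * s\<close> inverts \<open>a\<close>
    on \<open>aR\<close>, and \<open>\<beta> - z\<close> inverts \<open>- e\<close> on
    \<open>eR\<close>.\<close>
  define d where "d = y + w + \<beta>"
  define v where "v = d * s + \<beta> - z"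
  have zero: "z * \<alpha> = 0" "x * \<alpha> = 0" "y * \<alpha> = 0" "\<alpha> * y = 0" "\<alpha> * z = 0" "\<alpha> * w = 0"
    "\<beta> * x = 0" "\<beta> * y = 0" "\<beta> * z = 0" "w * \<beta> = 0" "y * \<beta> = 0" "z * \<beta> = 0"
    "\<alpha> * \<alpha> = 0" "\<beta> * \<beta> = 0" "a * \<beta> = 0" "z * a = 0" "w * a = 0" "\<beta> * a = 0"
    using iso orth a(3,4) by (metis mult.assoc mult_zero_left mult_zero_right distrib_left add_0)+
  have s0: "s * z = 0" "s * w = 0" "s * \<alpha> = 0"
    using a(2) orth zero by (metis mult.assoc mult_zero_right distrib_right add_0)+
  note tab = idem orth iso zero s0
  note tabs = tab tab[THEN mult_rewrite]
  have e_idem: "e * e = e"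
    by (simp add: e_def algebra_simps tabs)
  have ed: "e * d = 0"
    by (simp add: e_def d_def algebra_simps tabs)
  have "a * d = a * (x + y + z + w)"
    using a(4,5) by (simp add: d_def algebra_simps tabs)
  then have ad: "a * d = a"
    by (simp add: sum)
  have "a * (1 - s * a) = 0"
    using a(1,3) by (simp add: algebra_simps flip: mult.assoc)
  \<comment> \<open>\<open>1 - s * a\<close> has image in \<open>r(a)\<close>, which
    \<open>d\<close> kills.\<close>
  then have "x * (1 - s * a) + z * (1 - s * a) = 1 - s * a"
    by (rule a(6))
  then have "d * (1 - s * a) = d * (x * (1 - s * a) + z * (1 - s * a))"
    by simp
  also have "\<dots> = 0"
    by (simp add: d_def algebra_simps tabs)
  finally have dsa: "d * (s * a) = d"
    by (simp add: algebra_simps)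
  have se: "s * e = 0"
    by (simp add: e_def algebra_simps tabs)
  have "(a - e) * v = x + y + z + w"
  proof -
    have "(a - e) * v = a * d * s - e * d * s + a * (\<beta> - z) - e * (\<beta> - z)"
      by (simp add: v_def algebra_simps)
    also have "\<dots> = x + y - e * (\<beta> - z)"
      by (simp add: ad ed a(1,5) zero right_diff_distrib)
    also have "e * (\<beta> - z) = - z - w"
      by (simp add: e_def algebra_simps tabs)
    finally show ?thesis
      by simp
  qed
  moreover have "v * (a - e) = x + y + z + w"
  proof -
    have "v * (a - e) = d * (s * a) - d * (s * e) + (\<beta> - z) * a - (\<beta> - z) * e"
      by (simp add: v_def algebra_simps)
    also have "\<dots> = d - (\<beta> - z) * e"
      by (simp add: dsa se zero left_diff_distrib)
    also have "(\<beta> - z) * e = \<beta> - x - z"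
      by (simp add: e_def algebra_simps tabs)
    finally show ?thesis
      by (simp add: d_def)
  qed
  ultimately have "is_unit (a - e)"
    unfolding is_unit_def sum by blast
  moreover have "a * t = 0" if "a * t = e * t'" for t t'
  proof -
    \<comment> \<open>\<open>x + y\<close> fixes \<open>aR\<close> and annihilates
      \<open>e\<close>.\<close>
    have "a * t = (x + y) * a * t"
      by (simp add: a(3))
    also have "\<dots> = (x + y) * e * t'"
      by (simp add: that mult.assoc)
    also have "(x + y) * e = 0"
      by (simp add: e_def algebra_simps tabs)
    finally show ?thesis
      by simp
  qed
  then have "{a * t | t. True} \<inter> {e * t | t. True} = {0}"
    by (auto intro: exI[of _ 0])
  ultimately show ?thesis
    using e_idem by blast
qed

section \<open>Isomorphic complements\<close>

lemma rmod_iso_prin_add: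
  fixes x z :: "'r::ring_1"
  assumes "x * x = x" "z * z = z" "x * z = 0" "z * x = 0"
  shows "rmod_iso (prin (x + z)) (dsum (prin x) (prin z))"
proof (rule rmod_isoI[where f = "\<lambda>r. (x * r, z * r)" and g = "\<lambda>(r, s). r + s"])
  note tabs = assms assms[THEN mult_rewrite]
  show "rlinear (prin (x + z)) (dsum (prin x) (prin z)) (\<lambda>r. (x * r, z * r))"
    by (auto simp: rlinear_def prin_def rsub_def dsum_def algebra_simps tabs)
  show "(\<lambda>(r, s). r + s) (x * r, z * r) = r" if "r \<in> mcarr (prin (x + z))" for r
    using that by (simp add: prin_def rsub_def algebra_simps)
  have mixed: "x * s = 0" if "z * s = s" for s
    using assms(3) that by (metis mult.assoc mult_zero_left)
  have mixed': "z * s = 0" if "x * s = s" for s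
    using assms(4) that by (metis mult.assoc mult_zero_left)
  show "(\<lambda>(r, s). r + s) y \<in> mcarr (prin (x + z))"
    "(x * (\<lambda>(r, s). r + s) y, z * (\<lambda>(r, s). r + s) y) = y"
    if "y \<in> mcarr (dsum (prin x) (prin z))" for y
    using that by (auto simp: prin_def rsub_def dsum_def distrib_left distrib_right mixed mixed')
qed

text \<open>Both \<open>r(a)\<close> and a complement of \<open>aR\<close> complement a copy of \<open>(a - a^3)R\<close> in
  \<open>(1 - a^2)R\<close>: the first through multiplication by \<open>a\<close>, the second through inclusion.\<close>

lemma rmod_iso_kernel_cokernel:
  fixes a :: "'r::ring_1"
  defines "d \<equiv> a - a * (a * a)" and "q \<equiv> 1 - a * a"
  assumes t: "d * t * d = d"
    and ker: "a * k = 0" "\<And>r. a * r = 0 \<Longrightarrow> k * r = r"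
    and coker: "a * s + c = 1" "c * a = 0" "c * c = c"
  shows "rmod_iso (dsum (prin (d * t)) (prin k)) (dsum (prin (d * t)) (prin c))"
proof -
  \<comment> \<open>\<open>d * t\<close> is idempotent with image \<open>dR\<close>. The right ideal
    \<open>qR\<close> is given as a set, since \<open>q\<close> need not be idempotent.\<close>
  let ?U = "prin (d * t)" and ?P = "rsub (range (\<lambda>r. q * r))"
  have car: "mcarr (prin e) = {r. e * r = r}" "madd (prin e) r r' = r + r'" "msmul (prin e) r r' = r * r'"
    for e r r' :: 'r
    by (simp_all add: prin_def rsub_def)
  have P: "mcarr ?P = range (\<lambda>r. q * r)" "madd ?P r r' = r + r'" "msmul ?P r r' = r * r'" for r r'
    by (simp_all add: rsub_def)
  have D: "mcarr (dsum M N) = mcarr M \<times> mcarr N"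
    "madd (dsum M N) (m, n) (m', n') = (madd M m m', madd N n n')"
    "msmul (dsum M N) (m, n) r = (msmul M m r, msmul N n r)"
    for M :: "('r, 'r) rmod" and N :: "('r, 'r) rmod" and m n m' n' r
    by (simp_all add: dsum_def)
  have aq: "a * q = d" and qa: "q * a = d"
    by (simp_all add: d_def q_def algebra_simps)
  have q_ker: "r = q * r" if "a * r = 0" for r
    using that by (simp add: q_def algebra_simps)
  have ak: "a * r = 0" if "k * r = r" for r
    using that ker(1) by (metis mult.assoc mult_zero_left)
  have P_iff: "r \<in> range (\<lambda>r. q * r) \<longleftrightarrow> (\<exists>r'. r = q * r')" for r
    by auto
  have cd: "c * d = 0"
    using coker(2) aq by (metis mult.assoc mult_zero_left)
  have cU: "c * r = 0" if "d * t * r = r" for r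
    using that cd by (metis mult.assoc mult_zero_left)
  have cq: "c * (q * r) = c * r" for r
    using coker(2) by (simp add: q_def left_diff_distrib right_diff_distrib flip: mult.assoc)
  have 1: "rmod_iso (dsum ?U (prin k)) ?P"
  \<comment> \<open>Multiplication by \<open>a\<close> maps \<open>qR\<close> onto
    \<open>dR\<close>, as \<open>a * q = d\<close>, with kernel \<open>r(a)\<close>; the map
    \<open>u \<mapsto> q * (t * u)\<close> splits it.\<close>
  proof (rule rmod_isoI[where f = "\<lambda>(u, r). q * (t * u) + r" and g = "\<lambda>r. (a * r, r - q * (t * (a * r)))"])
    have "q * (t * u) + r \<in> range (\<lambda>r. q * r)" if "k * r = r" for u r
      unfolding P_iff using q_ker[OF ak[OF that]] by (metis distrib_left)
    then show "rlinear (dsum ?U (prin k)) ?P (\<lambda>(u, r). q * (t * u) + r)"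
      by (auto simp: rlinear_def D car P algebra_simps)
    have fwd: "a * (q * (t * u) + r) = u" if "d * t * u = u" "k * r = r" for u r
      using that ak[OF that(2)] aq by (simp add: distrib_left flip: mult.assoc)
    show "(\<lambda>r. (a * r, r - q * (t * (a * r)))) ((\<lambda>(u, r). q * (t * u) + r) p) = p"
      if "p \<in> mcarr (dsum ?U (prin k))" for p
      using that by (auto simp: D car fwd)
    fix p assume "p \<in> mcarr ?P"
    then obtain r where "p = q * r"
      by (auto simp: P)
    then have ap: "a * p = d * r"
      by (simp add: aq flip: mult.assoc)
    then have u: "d * t * (a * p) = a * p"
      using t by (metis mult.assoc)
    have "a * (p - q * (t * (a * p))) = 0"
      using u aq by (simp add: right_diff_distrib flip: mult.assoc)
    then show "(a * p, p - q * (t * (a * p))) \<in> mcarr (dsum ?U (prin k))"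
      using u by (simp add: D car ker(2))
  qed auto
  have 2: "rmod_iso (dsum ?U (prin c)) ?P"
  \<comment> \<open>Here \<open>c\<close> maps \<open>qR\<close> onto \<open>cR\<close>, split by
    multiplication by \<open>q\<close> because \<open>c * q = c\<close>. The kernel is
    \<open>q * a\<close> times \<open>R\<close>, that is, \<open>dR\<close>.\<close>
  proof (rule rmod_isoI[where f = "\<lambda>(u, r). u + q * r" and g = "\<lambda>r. (r - q * (c * r), c * r)"])
    have "u + q * r \<in> range (\<lambda>r. q * r)" if "d * t * u = u" for u r
      unfolding P_iff using that qa by (metis distrib_left mult.assoc)
    then show "rlinear (dsum ?U (prin c)) ?P (\<lambda>(u, r). u + q * r)"
      by (auto simp: rlinear_def D car P algebra_simps)
    have "c * (u + q * r) = r" if "d * t * u = u" "c * r = r" for u r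
      using that by (simp add: distrib_left cU cq)
    then show "(\<lambda>r. (r - q * (c * r), c * r)) ((\<lambda>(u, r). u + q * r) p) = p"
      if "p \<in> mcarr (dsum ?U (prin c))" for p
      using that by (auto simp: D car)
    fix p assume "p \<in> mcarr ?P"
    then obtain r where p: "p = q * r"
      by (auto simp: P)
    have "r - c * r = a * (s * r)"
      using coker(1) by (metis add_diff_cancel_right' left_diff_distrib mult.assoc mult_1_left)
    then have "p - q * (c * p) = d * (s * r)"
      using p qa by (metis cq mult.assoc right_diff_distrib)
    then have "d * t * (p - q * (c * p)) = p - q * (c * p)"
      using t by (metis mult.assoc)
    then show "(p - q * (c * p), c * p) \<in> mcarr (dsum ?U (prin c))"
      using coker(3) by (simp add: D car flip: mult.assoc)
  qed auto
  have "op_closed (dsum ?U (prin c))"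
    by (intro op_closed_dsum op_closed_prin)
  then show ?thesis
    by (rule rmod_iso_trans[OF 1 rmod_iso_sym[OF 2]])
qed

text \<open>In \<open>a = a^3 + (a - a^3) y (a - a^3)\<close> every summand begins and ends with a
  factor \<open>a\<close>.\<close>

lemma regular_of_regular_diff_cube:
  fixes a :: "'r::ring_1"
  assumes "regular (a - a ^ 3)"
  shows "regular a"
proof -
  obtain y where y: "a - a ^ 3 = (a - a ^ 3) * y * (a - a ^ 3)"
    using assms unfolding regular_def by blast
  have d: "a - a ^ 3 = a * (1 - a * a)" "a - a ^ 3 = (1 - a * a) * a"
    by (simp_all add: power3_eq_cube algebra_simps)
  have "a = a * a * a + (a - a ^ 3) * y * (a - a ^ 3)"
    using y by (simp add: power3_eq_cube algebra_simps)
  also have "\<dots> = a * a * a + a * (1 - a * a) * y * ((1 - a * a) * a)"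
    by (simp only: d(1)[symmetric] d(2)[symmetric])
  also have "\<dots> = a * (a + (1 - a * a) * y * (1 - a * a)) * a"
    by (simp add: algebra_simps)
  finally show ?thesis
    unfolding regular_def by blast
qed

theorem theorem3p7:
  fixes a :: "'r::ring_1"
  assumes "exchange_ring TYPE('r)"
    and "separative TYPE('r)"
    and "is_unit (2::'r)"
    and "regular (a - a ^ 3)"
    and "projective (quot_rmod {a * x | x. True} {a * y | y. y \<in> rann (a ^ 2)})"
    and "projective (quot_rmod UNIV {a * x + y | x y. y \<in> rann a})"
    and "gen_ideal {a * y | y. y \<in> rann (a ^ 2)} = gen_ideal {y * a | y. y \<in> lann (a ^ 2)}"
    and "gen_ideal {y * a | y. y \<in> lann (a ^ 2)} = gen_ideal {1 - a ^ 2}"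
  shows "\<exists>e::'r. e * e = e \<and> is_unit (a - e) \<and>
           {a * x | x. True} \<inter> {e * x | x. True} = {0}"
proof -
  obtain g where g: "g * g = g" "\<And>r. a * r \<in> {a * y | y. y \<in> rann (a ^ 2)} \<longleftrightarrow> g * r = 0"
  proof (rule projective_quot_split[OF assms(5)])
    fix x r assume "x \<in> {a * y | y. y \<in> rann (a ^ 2)}"
    then show "x * r \<in> {a * y | y. y \<in> rann (a ^ 2)}"
      by (force simp: rann_def mult.assoc simp flip: mult.assoc[of "a ^ 2"])
  next
    fix x y assume "x \<in> {a * y | y. y \<in> rann (a ^ 2)}" "y \<in> {a * y | y. y \<in> rann (a ^ 2)}"
    then obtain x' y' where "x = a * x'" "y = a * y'" "a ^ 2 * (x' + y') = 0"
      by (auto simp: rann_def distrib_left)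
    then have "x + y = a * (x' + y')" "x' + y' \<in> rann (a ^ 2)"
      by (simp_all add: rann_def distrib_left)
    then show "x + y \<in> {a * y | y. y \<in> rann (a ^ 2)}"
      by blast
  next
    show "0 \<in> {a * y | y. y \<in> rann (a ^ 2)}"
      by (auto simp: rann_def intro!: exI[of _ 0])
  qed (rule that)
  have g': "a * a * r = 0 \<longleftrightarrow> g * r = 0" for r
  proof -
    have "a * a * r = 0 \<longleftrightarrow> a * r \<in> {a * y | y. y \<in> rann (a ^ 2)}"
      unfolding rann_def power2_eq_square mem_Collect_eq by (metis mult.assoc)
    with g(2) show ?thesis
      by simp
  qed
  \<comment> \<open>Presents \<open>R\<close> as the cyclic module \<open>1R\<close>, so that the
    splitting lemma applies with generator 1.\<close>
  have UNIV1: "UNIV = {1 * x | x :: 'r. True}"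
    by simp
  obtain c where c: "c * c = c" "\<And>r. 1 * r \<in> {a * x + y | x y. y \<in> rann a} \<longleftrightarrow> c * r = 0"
  proof (rule projective_quot_split[OF assms(6)[unfolded UNIV1]])
    show "0 \<in> {a * x + y | x y. y \<in> rann a}"
      by (auto simp: rann_def intro!: exI[of _ 0])
  next
    fix u v assume "u \<in> {a * x + y | x y. y \<in> rann a}" "v \<in> {a * x + y | x y. y \<in> rann a}"
    then obtain x y x' y' where "u = a * x + y" "v = a * x' + y'" "a * y = 0" "a * y' = 0"
      by (auto simp: rann_def)
    then have "u + v = a * (x + x') + (y + y')" "a * (y + y') = 0"
      by (simp_all add: algebra_simps)
    then show "u + v \<in> {a * x + y | x y. y \<in> rann a}"
      unfolding rann_def by blast
  next
    fix u r assume "u \<in> {a * x + y | x y. y \<in> rann a}"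
    then obtain x y where "u = a * x + y" "a * y = 0"
      by (auto simp: rann_def)
    then have "u * r = a * (x * r) + y * r" "a * (y * r) = 0"
      by (simp_all add: algebra_simps flip: mult.assoc[of a y])
    then show "u * r \<in> {a * x + y | x y. y \<in> rann a}"
      unfolding rann_def by blast
  qed (rule that)
  have c': "(\<exists>s k. r = a * s + k \<and> a * k = 0) \<longleftrightarrow> c * r = 0" for r
    using c(2)[of r] by (simp add: rann_def)
  obtain x y z w s where
    idem: "x * x = x" "y * y = y" "z * z = z" "w * w = w"
    and orth: "x * y = 0" "x * z = 0" "x * w = 0" "y * x = 0" "y * z = 0" "y * w = 0"
    "z * x = 0" "z * y = 0" "z * w = 0" "w * x = 0" "w * y = 0" "w * z = 0"
    and sum: "x + y + z + w = 1"
    and a: "a * s = x + y" "s * (x + y) = s" "(x + y) * a = a" "a * x = 0" "a * z = 0"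
    and ker: "\<And>k. a * k = 0 \<Longrightarrow> x * k + z * k = k"
    by (rule image_kernel_decomposition[OF regular_of_regular_diff_cube[OF assms(4)] g' g(1) c' c(1)])
       (rule that; blast)
  obtain t where t: "(a - a * (a * a)) * t * (a - a * (a * a)) = a - a * (a * a)"
    using assms(4) unfolding regular_def power3_eq_cube mult.assoc[of a a a] by metis
  define u where "u = (a - a * (a * a)) * t"
  have uu: "u * u = u"
    using t by (simp add: u_def flip: mult.assoc)
  have za: "z * a = 0" and wa: "w * a = 0"
    using a(3) orth by (metis mult.assoc mult_zero_left distrib_left add_0)+

  \<comment> \<open>\<open>x + z\<close> has image \<open>r(a)\<close>, and
    \<open>z + w = 1 - a * s\<close> projects onto a complement of \<open>aR\<close>.\<close>
  have "rmod_iso (dsum (prin u) (prin (x + z))) (dsum (prin u) (prin (z + w)))"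
    unfolding u_def
  proof (rule rmod_iso_kernel_cokernel[OF t])
    show "a * s + (z + w) = 1"
      using sum a(1) by (simp add: add.assoc)
  qed (simp_all add: a ker za wa idem orth algebra_simps)
  moreover have "rmod_iso (dsum (prin x) (dsum (prin u) (prin z))) (dsum (prin u) (prin (x + z)))"
  proof -
    have "rmod_iso (dsum (prin x) (dsum (prin u) (prin z))) (dsum (dsum (prin x) (prin u)) (prin z))"
      by (rule rmod_iso_dsum_assoc')
    also have "rmod_iso \<dots> (dsum (dsum (prin u) (prin x)) (prin z))"
      by (rule rmod_iso_dsum[OF rmod_iso_dsum_comm rmod_iso_refl])
    also have "rmod_iso \<dots> (dsum (prin u) (dsum (prin x) (prin z)))"
      by (rule rmod_iso_dsum_assoc)
    also have "rmod_iso \<dots> (dsum (prin u) (prin (x + z)))"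
      by (rule rmod_iso_dsum[OF rmod_iso_refl
            rmod_iso_sym[OF rmod_iso_prin_add[OF idem(1,3) orth(2,7)] op_closed_prin]])
    finally show ?thesis .
  qed
  moreover have "rmod_iso (dsum (prin u) (prin (z + w))) (dsum (prin w) (dsum (prin u) (prin z)))"
  proof -
    have "rmod_iso (dsum (prin u) (prin (z + w))) (dsum (prin u) (dsum (prin z) (prin w)))"
      by (rule rmod_iso_dsum[OF rmod_iso_refl rmod_iso_prin_add[OF idem(3,4) orth(9,12)]])
    also have "rmod_iso \<dots> (dsum (dsum (prin u) (prin z)) (prin w))"
      by (rule rmod_iso_dsum_assoc')
    also have "rmod_iso \<dots> (dsum (prin w) (dsum (prin u) (prin z)))"
      by (rule rmod_iso_dsum_comm)
    finally show ?thesis .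
  qed
  ultimately have iso: "rmod_iso (dsum (prin x) (dsum (prin u) (prin z))) (dsum (prin w) (dsum (prin u) (prin z)))"
    by (blast intro: rmod_iso_trans)

  let ?J = "gen_ideal {1 - a ^ 2}"
  \<comment> \<open>\<open>a\<close> commutes with \<open>1 - a^2\<close>, so
    \<open>u = (1 - a^2) * (a * t)\<close>; likewise \<open>z = (1 - a^2) * z\<close> because
    \<open>a * z = 0\<close>.\<close>
  have uJ: "u \<in> ?J"
    using gen_ideal_mult[of "1 - a ^ 2" _ "a * t"] by (simp add: u_def power2_eq_square algebra_simps)
  have zJ: "z \<in> ?J"
    using gen_ideal_mult[of "1 - a ^ 2" _ z] a(5) by (simp add: power2_eq_square algebra_simps)
  \<comment> \<open>Such an \<open>r\<close> lies in both \<open>aR\<close> and \<open>r(a)\<close>: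
    the former gives \<open>z * r = 0\<close>, the latter \<open>x * r + z * r = r\<close>.\<close>
  have "r = x * r" if "r = a * y'" "a ^ 2 * y' = 0" for r y'
    using that ker[of r] za by (simp add: power2_eq_square mult.assoc) (simp flip: mult.assoc)
  then have Jx: "?J \<subseteq> trace_ideal x"
    unfolding assms(7,8)[symmetric] by (intro gen_ideal_subset_trace_ideal) (auto simp: rann_def)
  \<comment> \<open>Dually, \<open>r\<close> annihilates \<open>aR\<close>, the image of
    \<open>x + y\<close>, and also \<open>x\<close> and \<open>z\<close>; of
    \<open>r * (x + y + z + w)\<close> only \<open>r * w\<close> survives.\<close>
  have "r = r * w" if "r = y' * a" "y' * a ^ 2 = 0" for r y'
  proof -
    have "r * (x + y) = y' * a ^ 2 * s"
      by (simp add: that(1) a(1) power2_eq_square mult.assoc flip: a(1))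
    then have "r * x + r * y = 0" "r * x = 0" "r * z = 0"
      using that a(4,5) by (simp_all add: distrib_left mult.assoc)
    moreover have "r * (x + y + z + w) = r"
      by (simp add: sum)
    ultimately show ?thesis
      by (simp add: distrib_left)
  qed
  then have Jw: "?J \<subseteq> trace_ideal w"
    unfolding assms(8)[symmetric] by (intro gen_ideal_subset_trace_ideal) (auto simp: lann_def)
  \<comment> \<open>\<open>u\<close> and \<open>z\<close> are treated separately; the complements
    \<open>T1\<close> and \<open>T2\<close> combine to one for
    \<open>dsum (prin u) (prin z)\<close>.\<close>
  have summand: "\<exists>n (T :: ((nat \<Rightarrow> 'r) \<times> (nat \<Rightarrow> 'r), 'r) rmod). op_closed T \<and>
      rmod_iso (dsum (dsum (prin u) (prin z)) T) (pmod (replicate n v))"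
    if J: "?J \<subseteq> trace_ideal v" and v: "v * v = v" for v
  proof -
    obtain n1 and T1 :: "(nat \<Rightarrow> 'r, 'r) rmod" where T1: "op_closed T1" "rmod_iso (dsum (prin u) T1) (pmod (replicate n1 v))"
      by (rule trace_ideal_summand[OF uu v subsetD[OF J uJ]]) (rule that)
    obtain n2 and T2 :: "(nat \<Rightarrow> 'r, 'r) rmod" where T2: "op_closed T2" "rmod_iso (dsum (prin z) T2) (pmod (replicate n2 v))"
      by (rule trace_ideal_summand[OF idem(3) v subsetD[OF J zJ]]) (rule that)
    have "rmod_iso (dsum (dsum (prin u) (prin z)) (dsum T1 T2)) (dsum (dsum (prin u) T1) (dsum (prin z) T2))"
      by (rule rmod_isoI[where f = "\<lambda>((a, b), c, d). ((a, c), b, d)" and g = "\<lambda>((a, b), c, d). ((a, c), b, d)"])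
        (auto simp: rlinear_def dsum_def)
    also have "rmod_iso \<dots> (dsum (pmod (replicate n1 v)) (pmod (replicate n2 v)))"
      by (intro rmod_iso_dsum T1 T2)
    also have "rmod_iso \<dots> (pmod (replicate (n1 + n2) v))"
      using rmod_iso_pmod_append by (simp add: replicate_add)
    finally show ?thesis
      using op_closed_dsum[OF T1(1) T2(1)] by blast
  qed
  obtain n T where T: "op_closed (T :: ((nat \<Rightarrow> 'r) \<times> (nat \<Rightarrow> 'r), 'r) rmod)"
    "rmod_iso (dsum (dsum (prin u) (prin z)) T) (copies x w n 0)"
    using summand[OF Jx idem(1)] by (auto simp: copies_def)
  obtain m T' where T': "op_closed (T' :: ((nat \<Rightarrow> 'r) \<times> (nat \<Rightarrow> 'r), 'r) rmod)"
    "rmod_iso (dsum (dsum (prin u) (prin z)) T') (copies x w 0 m)"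
    using summand[OF Jw idem(4)] by (auto simp: copies_def)
  have "rmod_iso (prin x) (prin w)"
    using separative_cancel[OF assms(2) idem(1,4) _ T(1) T'(1) iso T(2) T'(2)]
    by (simp add: op_closed_dsum op_closed_prin)
  then obtain \<alpha> \<beta> where iso:
    "w * \<alpha> = \<alpha>" "\<alpha> * x = \<alpha>" "x * \<beta> = \<beta>" "\<beta> * w = \<beta>" "\<beta> * \<alpha> = x" "\<alpha> * \<beta> = w"
    using idem(1,4) by (rule rmod_iso_prinE) (rule that)
  show ?thesis
    by (rule special_clean_of_iso[OF idem orth sum a ker iso])
qed

end
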